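(* For any real numbers $p\geq1$ and $\sigma\geq1/2$, one has \[ \sup_{0\neq b\in\ell^{p}(\mathbb{Z})}\frac{1}{\|b\|_{\ell^{p}}^{p}}\sum_{\lambda\in\sigma_{d}(T(b))}\frac{\left(\operatorname{dist}(\lambda,[-2,2])\right)^{p}}{|\lambda^{2}-4|^{\sigma}}=\infty, \] where the supremum is over complex-valued sequences $b\in\ell^p(\mathbb{Z})$ and $T(b)$ is the discrete Schrödinger operator on $\ell^2(\mathbb{Z})$ with potential $b$.
   Context: Let $\{e_n\}_{n\in\mathbb{Z}}$ be the standard basis of $\ell^2(\mathbb{Z})$. For a complex sequence $b=\{b_n\}_{n\in\mathbb{Z}}\in\ell^p(\mathbb{Z})$, $T(b)$ is the bounded operator on $\ell^2(\mathbb{Z})$ determined by $T(b)e_n=e_{n-1}+b_ne_n+e_{n+1}$, $n\in\mathbb{Z}$. Since $b_n\to0$ as $n\to\pm\infty$, the essential spectrum of $T(b)$ is $[-2,2]$; the discrete spectrum is $\sigma_d(T(b))=\sigma(T(b))\setminus[-2,2]$, an at most countable set of eigenvalues with all accumulation points in $[-2,2]$. The sum runs over the elements of the set $\sigma_d(T(b))$ and takes values in $[0,\infty]$. *)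

theory Defs
  imports "HOL-Analysis.Analysis"
begin

definition lp :: "real \<Rightarrow> (int \<Rightarrow> complex) set" where
  "lp p = {u. (\<lambda>n. cmod (u n) powr p) summable_on UNIV}"

definition lp_norm :: "real \<Rightarrow> (int \<Rightarrow> complex) \<Rightarrow> real" where
  "lp_norm p u = (\<Sum>\<^sub>\<infinity>n. cmod (u n) powr p) powr (1 / p)"

text \<open>
  Operators on \<open>\<ell>\<^sup>2(\<int>)\<close> are functions on all sequences of which only the restriction to
  \<open>lp 2\<close> matters.
\<close>

definition l2_bounded_operator :: "((int \<Rightarrow> complex) \<Rightarrow> (int \<Rightarrow> complex)) \<Rightarrow> bool" where
  "l2_bounded_operator A \<longleftrightarrow>
     (\<forall>u \<in> lp 2. A u \<in> lp 2) \<and>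
     (\<forall>u \<in> lp 2. \<forall>v \<in> lp 2. A (\<lambda>n. u n + v n) = (\<lambda>n. A u n + A v n)) \<and>
     (\<forall>c. \<forall>u \<in> lp 2. A (\<lambda>n. c * u n) = (\<lambda>n. c * A u n)) \<and>
     (\<exists>K. \<forall>u \<in> lp 2. lp_norm 2 (A u) \<le> K * lp_norm 2 u)"

definition l2_resolvent_set :: "((int \<Rightarrow> complex) \<Rightarrow> (int \<Rightarrow> complex)) \<Rightarrow> complex set" where
  "l2_resolvent_set A =
     {z. \<exists>R. l2_bounded_operator R \<and>
        (\<forall>u \<in> lp 2. R (\<lambda>n. A u n - z * u n) = u \<and> (\<lambda>n. A (R u) n - z * R u n) = u)}"

definition l2_spectrum :: "((int \<Rightarrow> complex) \<Rightarrow> (int \<Rightarrow> complex)) \<Rightarrow> complex set" where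
  "l2_spectrum A = - l2_resolvent_set A"

definition std_basis :: "int \<Rightarrow> int \<Rightarrow> complex" where
  "std_basis k = (\<lambda>n. if n = k then 1 else 0)"

text \<open>
  The coordinate form of the operator; \<open>schrodinger_bounded\<close>, \<open>schrodinger_basis\<close> and
  \<open>schrodinger_unique\<close> below show that it is the bounded operator determined by
  \<open>e\<^sub>k \<mapsto> e\<^sub>k\<^sub>-\<^sub>1 + b\<^sub>k e\<^sub>k + e\<^sub>k\<^sub>+\<^sub>1\<close>.
\<close>

definition schrodinger :: "(int \<Rightarrow> complex) \<Rightarrow> (int \<Rightarrow> complex) \<Rightarrow> (int \<Rightarrow> complex)" where
  "schrodinger b u = (\<lambda>n. u (n - 1) + b n * u n + u (n + 1))"

definition essential_interval :: "complex set" where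
  "essential_interval = complex_of_real ` {-2..2}"

definition discrete_spectrum :: "(int \<Rightarrow> complex) \<Rightarrow> complex set" where
  "discrete_spectrum b = l2_spectrum (schrodinger b) - essential_interval"

lemma schrodinger_basis:
  "schrodinger b (std_basis k) =
     (\<lambda>n. std_basis (k - 1) n + b k * std_basis k n + std_basis (k + 1) n)"
  by (auto simp: schrodinger_def std_basis_def fun_eq_iff)

lemma lp2_iff: "u \<in> lp 2 \<longleftrightarrow> (\<lambda>n. (cmod (u n))\<^sup>2) summable_on UNIV"
  by (simp add: lp_def)

lemma lp2_norm: "lp_norm 2 u = sqrt (\<Sum>\<^sub>\<infinity>n. (cmod (u n))\<^sup>2)"
  by (simp add: lp_norm_def powr_half_sqrt infsum_nonneg)

lemma lp_imp_bounded:
  assumes "b \<in> lp p" "p \<ge> 1"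
  shows "\<exists>B. \<forall>n. cmod (b n) \<le> B"
proof -
  define S where "S = (\<Sum>\<^sub>\<infinity>n. cmod (b n) powr p)"
  have s: "(\<lambda>n. cmod (b n) powr p) summable_on UNIV" using assms by (simp add: lp_def)
  have "cmod (b n) \<le> S powr (1/p)" for n
  proof -
    have "(\<Sum>k\<in>{n}. cmod (b k) powr p) \<le> S"
      unfolding S_def by (rule finite_sum_le_infsum[OF s]) auto
    then have "(cmod (b n) powr p) powr (1/p) \<le> S powr (1/p)"
      using assms by (intro powr_mono2) auto
    then show ?thesis using assms by (simp add: powr_powr)
  qed
  then show ?thesis by blast
qed

lemma sum3_sq: "(x + y + z)\<^sup>2 \<le> 3 * (x\<^sup>2 + y\<^sup>2 + z\<^sup>2)" for x y z :: real
proof -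
  have "0 \<le> (x - y)\<^sup>2 + (y - z)\<^sup>2 + (x - z)\<^sup>2" by simp
  then show ?thesis by (simp add: power2_eq_square algebra_simps)
qed

lemma shift_infsum:
  fixes f :: "int \<Rightarrow> real"
  shows "(\<Sum>\<^sub>\<infinity>n. f (n + k)) = (\<Sum>\<^sub>\<infinity>n. f n)"
    and "(\<lambda>n. f (n + k)) summable_on UNIV \<longleftrightarrow> f summable_on UNIV"
proof -
  have b: "bij_betw (\<lambda>n. n + k) UNIV (UNIV :: int set)"
    by (rule bij_betwI[where g = "\<lambda>n. n - k"]) auto
  show "(\<Sum>\<^sub>\<infinity>n. f (n + k)) = (\<Sum>\<^sub>\<infinity>n. f n)"
    by (rule infsum_reindex_bij_betw[OF b])
  show "(\<lambda>n. f (n + k)) summable_on UNIV \<longleftrightarrow> f summable_on UNIV"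
    by (rule summable_on_reindex_bij_betw[OF b])
qed

theorem schrodinger_bounded:
  assumes "b \<in> lp p" "p \<ge> 1"
  shows "l2_bounded_operator (schrodinger b)"
proof -
  obtain B where B: "\<And>n. cmod (b n) \<le> B" using lp_imp_bounded[OF assms] by blast
  have main: "schrodinger b u \<in> lp 2 \<and>
      lp_norm 2 (schrodinger b u) \<le> sqrt (3 * (2 + B\<^sup>2)) * lp_norm 2 u" if u: "u \<in> lp 2" for u
  proof -
    define f where "f n = (cmod (u n))\<^sup>2" for n
    define g where "g n = 3 * (f (n + (-1)) + B\<^sup>2 * f n + f (n + 1))" for n
    have s: "f summable_on UNIV" using u unfolding f_def by (simp add: lp2_iff)
    note s1 = shift_infsum(2)[of f "-1", THEN iffD2, OF s]
    note s2 = shift_infsum(2)[of f 1, THEN iffD2, OF s]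
    have "(g has_sum 3 * (infsum f UNIV + B\<^sup>2 * infsum f UNIV + infsum f UNIV)) UNIV"
      unfolding g_def
      using has_sum_infsum[OF s1] has_sum_infsum[OF s2] has_sum_infsum[OF s]
      unfolding shift_infsum(1)
      by (intro has_sum_cmult_right has_sum_add)
    then have g: "g summable_on UNIV" and ig: "infsum g UNIV = 3 * (2 + B\<^sup>2) * infsum f UNIV"
      by (auto simp: has_sum_imp_summable infsumI algebra_simps)
    have le: "(cmod (schrodinger b u n))\<^sup>2 \<le> g n" for n
    proof -
      have "cmod (schrodinger b u n) \<le> cmod (u (n - 1)) + B * cmod (u n) + cmod (u (n + 1))"
        unfolding schrodinger_def
        by (intro order_trans[OF norm_triangle_ineq] add_mono)
           (auto simp: norm_mult intro!: mult_right_mono B)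
      then have "(cmod (schrodinger b u n))\<^sup>2
          \<le> (cmod (u (n - 1)) + B * cmod (u n) + cmod (u (n + 1)))\<^sup>2"
        by (intro power_mono) auto
      also have "\<dots> \<le> g n"
        using sum3_sq[of "cmod (u (n - 1))" "B * cmod (u n)" "cmod (u (n + 1))"]
        by (simp add: g_def f_def power_mult_distrib)
      finally show ?thesis .
    qed
    have sT: "(\<lambda>n. (cmod (schrodinger b u n))\<^sup>2) summable_on UNIV"
      by (rule summable_on_comparison_test[OF g]) (auto intro: le)
    have "(\<Sum>\<^sub>\<infinity>n. (cmod (schrodinger b u n))\<^sup>2) \<le> infsum g UNIV"
      by (rule infsum_mono[OF sT g le])
    then show ?thesis
      using sT unfolding ig lp2_norm lp2_iff f_def
      by (simp flip: real_sqrt_mult)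
  qed
  have "schrodinger b (\<lambda>n. u n + v n) = (\<lambda>n. schrodinger b u n + schrodinger b v n)"
    and "schrodinger b (\<lambda>n. c * u n) = (\<lambda>n. c * schrodinger b u n)" for u v c
    by (auto simp: schrodinger_def fun_eq_iff algebra_simps)
  with main show ?thesis
    unfolding l2_bounded_operator_def by blast
qed

lemma lp2_finite_support:
  assumes "finite F" "\<And>n. n \<notin> F \<Longrightarrow> u n = 0"
  shows "u \<in> lp 2"
  unfolding lp2_iff
  by (rule summable_on_cong_neutral[where T = F, THEN iffD2])
     (use assms in \<open>auto intro: summable_on_finite\<close>)

lemma lp2_coord_le:
  assumes "u \<in> lp 2"
  shows "cmod (u n) \<le> lp_norm 2 u"
proof -
  have "(\<Sum>k\<in>{n}. (cmod (u k))\<^sup>2) \<le> (\<Sum>\<^sub>\<infinity>k. (cmod (u k))\<^sup>2)"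
    using assms by (intro finite_sum_le_infsum) (auto simp: lp2_iff)
  then show ?thesis unfolding lp2_norm by (auto intro: real_le_rsqrt)
qed

lemma l2_operators_agree:
  assumes A: "l2_bounded_operator A" and A': "l2_bounded_operator A'"
    and e: "\<And>k. A (std_basis k) = A' (std_basis k)" and u: "u \<in> lp 2"
  shows "A u = A' u"
proof -
  have add: "\<And>u v. u \<in> lp 2 \<Longrightarrow> v \<in> lp 2 \<Longrightarrow> C (\<lambda>n. u n + v n) = (\<lambda>n. C u n + C v n)"
    and scale: "\<And>c u. u \<in> lp 2 \<Longrightarrow> C (\<lambda>n. c * u n) = (\<lambda>n. c * C u n)"
    and maps: "\<And>u. u \<in> lp 2 \<Longrightarrow> C u \<in> lp 2" if "l2_bounded_operator C" for C
    using that unfolding l2_bounded_operator_def by blast+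
  obtain K where K: "\<And>v. v \<in> lp 2 \<Longrightarrow> lp_norm 2 (A v) \<le> K * lp_norm 2 v"
    using A unfolding l2_bounded_operator_def by blast
  obtain K' where K': "\<And>v. v \<in> lp 2 \<Longrightarrow> lp_norm 2 (A' v) \<le> K' * lp_norm 2 v"
    using A' unfolding l2_bounded_operator_def by blast
  have eb: "std_basis k \<in> lp 2" for k
    by (rule lp2_finite_support[of "{k}"]) (auto simp: std_basis_def)
  define cut where "cut F = (\<lambda>n. if n \<in> F then u n else 0)" for F
  define tail where "tail F = (\<lambda>n. if n \<in> F then 0 else u n)" for F
  have cut: "cut F \<in> lp 2" if "finite F" for F
    by (rule lp2_finite_support[OF that]) (simp add: cut_def)
  have tail: "tail F \<in> lp 2" for F
    unfolding lp2_iff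
    by (rule summable_on_comparison_test[OF u[unfolded lp2_iff]]) (auto simp: tail_def)
  have agree: "A (cut F) = A' (cut F)" if "finite F" for F
    using that
  proof induction
    case empty
    have "cut {} = (\<lambda>n. 0 * std_basis 0 n)" by (simp add: cut_def)
    then show ?case using scale[OF A eb, of 0] scale[OF A' eb, of 0] by simp
  next
    case (insert k F)
    have se: "(\<lambda>n. u k * std_basis k n) \<in> lp 2"
      by (rule lp2_finite_support[of "{k}"]) (auto simp: std_basis_def)
    have "cut (insert k F) = (\<lambda>n. cut F n + u k * std_basis k n)"
      using insert by (auto simp: cut_def std_basis_def fun_eq_iff)
    then show ?case
      using insert add[OF A cut se] add[OF A' cut se] scale[OF A eb] scale[OF A' eb] e by simp
  qed
  have bound: "cmod (A u n - A' u n) \<le> (K + K') * lp_norm 2 (tail F)" if F: "finite F" for F n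
  proof -
    have "u = (\<lambda>n. cut F n + tail F n)" by (auto simp: cut_def tail_def)
    then have "A u n - A' u n = A (tail F) n - A' (tail F) n"
      using add[OF A cut[OF F] tail[of F]] add[OF A' cut[OF F] tail[of F]] agree[OF F] by simp
    also have "cmod \<dots> \<le> cmod (A (tail F) n) + cmod (A' (tail F) n)"
      by (rule norm_triangle_ineq4)
    also have "\<dots> \<le> (K + K') * lp_norm 2 (tail F)"
      using lp2_coord_le[OF maps[OF A tail[of F]], of n] K[OF tail[of F]]
        lp2_coord_le[OF maps[OF A' tail[of F]], of n] K'[OF tail[of F]]
      by (simp add: algebra_simps)
    finally show ?thesis .
  qed
  define f where "f n = (cmod (u n))\<^sup>2" for n
  have s: "f summable_on UNIV" using u unfolding f_def by (simp add: lp2_iff)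
  have tn: "lp_norm 2 (tail F) = sqrt (infsum f UNIV - sum f F)" if F: "finite F" for F
  proof -
    have "(\<Sum>\<^sub>\<infinity>n. (cmod (tail F n))\<^sup>2) = infsum f (UNIV - F)"
      by (rule infsum_cong_neutral) (auto simp: tail_def f_def)
    also have "\<dots> = infsum f UNIV - infsum f F"
      by (rule infsum_Diff) (use s F in auto)
    finally show ?thesis using F by (simp add: lp2_norm)
  qed
  have lim: "((\<lambda>F. (K + K') * sqrt (infsum f UNIV - sum f F)) \<longlongrightarrow>
      (K + K') * sqrt (infsum f UNIV - infsum f UNIV)) (finite_subsets_at_top UNIV)"
    by (intro tendsto_intros infsum_tendsto s)
  have "cmod (A u n - A' u n) \<le> (K + K') * sqrt (infsum f UNIV - infsum f UNIV)" for n
    by (rule tendsto_lowerbound[OF lim])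
       (use bound tn in \<open>auto intro!: eventually_finite_subsets_at_top_weakI\<close>)
  then show ?thesis by (auto simp: fun_eq_iff)
qed

corollary schrodinger_unique:
  assumes "b \<in> lp p" "p \<ge> 1" "l2_bounded_operator A"
    and "\<And>k. A (std_basis k) =
      (\<lambda>n. std_basis (k - 1) n + b k * std_basis k n + std_basis (k + 1) n)"
    and "u \<in> lp 2"
  shows "A u = schrodinger b u"
  using l2_operators_agree[OF assms(3) schrodinger_bounded[OF assms(1,2)]] assms(4,5)
  by (simp add: schrodinger_basis)

end

theory Submission
  imports Defs
begin

text \<open>
  Take a weak, long imaginary square well: \<open>b = \<i> h\<close> on \<open>{1..N}\<close> and \<open>0\<close> elsewhere. As \<open>N\<close> grows
  with \<open>h\<close> fixed, \<open>T(b)\<close> has about \<open>N\<close> eigenvalues close to the shifted segment \<open>\<i> h + [-2, 2]\<close>,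
  one near each \<open>\<i> h + 2 cos \<theta>\<close> with \<open>\<theta> = 2 \<pi> j / N\<close>. Each is at distance at least \<open>h / 2\<close> from
  \<open>[-2, 2]\<close>, and \<open>\<bar>\<lambda>\<^sup>2 - 4\<bar>\<close> is of order \<open>\<theta>\<^sup>2\<close> as long as \<open>\<theta>\<^sup>2 \<ge> h\<close>. After division by
  \<open>\<parallel>b\<parallel>\<^sup>p = N h\<^sup>p\<close> the eigenvalue sum is therefore bounded below by a harmonic sum over
  \<open>\<surd>h \<le> \<theta> \<le> 1\<close>, which grows like \<open>log (1 / h)\<close>.

  With \<open>\<lambda> = k + 1 / k = w + 1 / w + \<i> h\<close>, \<open>\<bar>k\<bar> < 1\<close> and \<open>w = exp (\<i> z)\<close>, the antisymmetric
  eigenvectors correspond to solutions of \<open>w\<^sup>N = (1 - k w) / (w - k)\<close>. Writing the right-hand side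
  as \<open>exp (\<phi> z)\<close>, the solutions are the fixed points of \<open>z \<mapsto> 2 \<pi> j / N - \<i> \<phi> z / N\<close>, which
  exist by Brouwer's theorem since \<open>\<phi>\<close> is bounded near the real interval independently of \<open>N\<close>.
\<close>

section \<open>Eigenvectors in the sequence space\<close>

text \<open>A resolvent at \<open>z\<close> would send the zero sequence \<open>A u - z u\<close> to
  \<open>u\<close>, whereas linearity forces it to send zero to zero.\<close>

lemma eigenvalue_in_l2_spectrum:
  assumes u: "u \<in> lp 2" "u \<noteq> (\<lambda>n. 0)" and eq: "A u = (\<lambda>n. z * u n)"
  shows "z \<in> l2_spectrum A"
proof (rule ccontr)
  assume "z \<notin> l2_spectrum A"
  then obtain R where R: "l2_bounded_operator R" "R (\<lambda>n. A u n - z * u n) = u"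
    using u(1) unfolding l2_spectrum_def l2_resolvent_set_def by blast
  have "R (\<lambda>n. 0 * u n) = (\<lambda>n. 0 * R u n)"
    using R(1) u(1) unfolding l2_bounded_operator_def by blast
  with R(2) eq u(2) show False by simp
qed

lemma lp2_geometric_tails:
  fixes k :: complex
  assumes k: "cmod k < 1"
    and neg: "\<And>j. u (- int j) = a * k ^ j" and pos: "\<And>j. u (int N + int j) = c * k ^ j"
  shows "u \<in> lp 2"
proof -
  have geo: "(\<lambda>j. (cmod (d * k ^ j))\<^sup>2) summable_on (UNIV :: nat set)" for d
  proof -
    have "(cmod k)\<^sup>2 < 1" using k by (simp add: power_less_one_iff)
    then have "summable (\<lambda>j. (cmod d)\<^sup>2 * ((cmod k)\<^sup>2) ^ j)"
      by (intro summable_mult summable_geometric) simp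
    then show ?thesis
      by (subst summable_on_UNIV_nonneg_real_iff)
         (simp_all add: norm_mult norm_power power_mult_distrib mult.commute flip: power_mult)
  qed
  let ?f = "\<lambda>n. (cmod (u n))\<^sup>2"
  have "?f summable_on range (\<lambda>j. - int j)"
    using geo[of a] by (subst summable_on_reindex) (auto simp: inj_on_def o_def neg)
  moreover have "?f summable_on range (\<lambda>j. int N + int j)"
    using geo[of c] by (subst summable_on_reindex) (auto simp: inj_on_def o_def pos)
  ultimately have "?f summable_on range (\<lambda>j. - int j) \<union> range (\<lambda>j. int N + int j) \<union> {0..int N}"
    by (intro summable_on_union) auto
  also have "range (\<lambda>j. - int j) \<union> range (\<lambda>j. int N + int j) \<union> {0..int N} = UNIV"
  proof (intro equalityI subsetI UNIV_I)
    fix n :: int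
    consider "n = - int (nat (- n))" | "n = int N + int (nat (n - int N))" | "n \<in> {0..int N}"
      by (cases "n \<le> 0"; cases "n \<le> int N") auto
    then show "n \<in> range (\<lambda>j. - int j) \<union> range (\<lambda>j. int N + int j) \<union> {0..int N}"
      by cases blast+
  qed
  finally show ?thesis by (simp add: lp2_iff)
qed

section \<open>Antisymmetric eigenvectors of the square well\<close>

definition square_well :: "complex \<Rightarrow> nat \<Rightarrow> int \<Rightarrow> complex" where
  "square_well c N n = (if 1 \<le> n \<and> n \<le> int N then c else 0)"

lemma geometric_recurrence:
  fixes x :: complex
  assumes "x \<noteq> 0"
  shows "x powi (n - 1) + x powi (n + 1) = (x + 1 / x) * x powi n"
  using assms by (simp add: power_int_add power_int_diff field_simps)

text \<open>Decaying powers of \<open>k\<close> outside the well are glued to a combination of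
  powers of \<open>w\<close> inside. Under the reflection \<open>n\<close> to
  \<open>N + 1 - n\<close> the middle piece changes sign and the outer pieces are exchanged up to
  sign, so one matching condition serves both ends; it is \<open>quant\<close>.\<close>

lemma square_well_eigenvalue:
  fixes w k :: complex
  assumes k: "k \<noteq> 0" "cmod k < 1" and w: "w \<noteq> 0" "w\<^sup>2 \<noteq> 1" and N: "N \<ge> 1"
    and disp: "k + 1 / k = w + 1 / w + c"
    and quant: "w ^ N * (w - k) = 1 - k * w"
  shows "k + 1 / k \<in> l2_spectrum (schrodinger (square_well c N))"
proof -
  \<comment> \<open>This is \<open>F2 0\<close>, so the left piece matches at site 0 by
    construction.\<close>
  define A where "A = 1 - w ^ (N + 1)"
  define F1 where "F1 n = A * k powi (- n)" for n
  define F2 where "F2 n = w powi n - w powi (int N + 1 - n)" for n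
  define F3 where "F3 n = - A * k powi (n - int N - 1)" for n
  define u where "u n = (if n \<le> 0 then F1 n else if n \<le> int N then F2 n else F3 n)" for n
  \<comment> \<open>Up to the factor \<open>k\<close>, this is the matching
    \<open>F1 1 = F2 1\<close> at site 1.\<close>
  have match: "A = k * (w - w ^ N)" using quant by (simp add: A_def algebra_simps)
  have F12: "F1 0 = F2 0" "F1 1 = F2 1"
    using match k by (simp_all add: F1_def F2_def A_def power_int_add w)
      (simp add: field_simps power_int_minus)
  have "F3 (int N + 1) = F2 (int N + 1)"
    by (simp add: F3_def F2_def A_def power_int_add w)
  moreover have "A * inverse k = w - w ^ N" using match k by (simp add: field_simps)
  then have "F3 (int N) = F2 (int N)" by (simp add: F3_def F2_def power_int_minus)
  ultimately have F23: "F3 (int N + 1) = F2 (int N + 1)" "F3 (int N) = F2 (int N)" by auto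
  \<comment> \<open>Matching at two adjacent sites extends each formula one site further. Every site
    then lies with both neighbours in the range of a single formula, and its three-term recurrence
    applies.\<close>
  have u1: "u n = F1 n" if "n \<le> 1" for n
    using that F12 N by (cases "n = 1") (auto simp: u_def)
  have u3: "u n = F3 n" if "n \<ge> int N" for n
    using that F23 N by (cases "n = int N") (auto simp: u_def)
  have u2: "u n = F2 n" if "0 \<le> n" "n \<le> int N + 1" for n
    using that F12 F23 N by (cases "n = 0"; cases "n = int N + 1") (auto simp: u_def)
  have r1: "F1 (n - 1) + F1 (n + 1) = (k + 1 / k) * F1 n" for n
  proof -
    have "- (n - 1) = - n + 1" "- (n + 1) = - n - 1" by simp_all
    then have "F1 (n - 1) + F1 (n + 1) = A * (k powi (- n - 1) + k powi (- n + 1))"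
      by (simp only: F1_def distrib_left add.commute)
    then show ?thesis unfolding geometric_recurrence[OF k(1)] by (simp add: F1_def)
  qed
  have r3: "F3 (n - 1) + F3 (n + 1) = (k + 1 / k) * F3 n" for n
  proof -
    have "F3 (n - 1) + F3 (n + 1)
        = - A * (k powi (n - int N - 1 - 1) + k powi (n - int N - 1 + 1))"
      by (simp add: F3_def algebra_simps)
    then show ?thesis unfolding geometric_recurrence[OF k(1)] by (simp add: F3_def)
  qed
  have r2: "F2 (n - 1) + F2 (n + 1) = (w + 1 / w) * F2 n" for n
  proof -
    have "F2 (n - 1) + F2 (n + 1) = (w powi (n - 1) + w powi (n + 1))
        - (w powi (int N + 1 - n - 1) + w powi (int N + 1 - n + 1))"
      by (simp add: F2_def algebra_simps)
    then show ?thesis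
      unfolding geometric_recurrence[OF w(1)] by (simp add: F2_def algebra_simps)
  qed
  have "schrodinger (square_well c N) u n = (k + 1 / k) * u n" for n
  proof -
    consider "n \<le> 0" | "n \<ge> int N + 1" | "1 \<le> n" "n \<le> int N" by linarith
    then show ?thesis
    proof cases
      case 1
      then show ?thesis using r1[of n] by (simp add: schrodinger_def square_well_def u1)
    next
      case 2
      then show ?thesis using r3[of n] by (simp add: schrodinger_def square_well_def u3)
    next
      case 3
      then show ?thesis using r2[of n] unfolding disp
        by (simp add: schrodinger_def square_well_def u2 algebra_simps)
    qed
  qed
  then have "schrodinger (square_well c N) u = (\<lambda>n. (k + 1 / k) * u n)" by blast
  moreover have "u \<in> lp 2"
  proof (rule lp2_geometric_tails[OF k(2)])
    show "u (- int j) = A * k ^ j" for j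
      by (simp add: u1 F1_def)
    show "u (int N + int j) = - A / k * k ^ j" for j
      using k(1) by (simp add: u3 F3_def power_int_diff)
  qed
  moreover have "u \<noteq> (\<lambda>n. 0)"
  proof
    assume "u = (\<lambda>n. 0)"
    then have "F2 0 = 0" "F2 1 = 0" using u2[of 0] u2[of 1] N by simp_all
    then have "w ^ (N + 1) = 1" "w ^ N = w" by (simp_all add: F2_def power_int_add w)
    with w(2) show False by (simp add: power2_eq_square)
  qed
  ultimately show ?thesis by (rule eigenvalue_in_l2_spectrum[rotated 2])
qed

section \<open>The inverse Joukowsky map on the upper half-plane\<close>

text \<open>Two separate roots replace a root of \<open>z\<^sup>2 - 4\<close>: for
  \<open>Im z > 0\<close> neither \<open>z + 2\<close> nor \<open>z - 2\<close> meets the branch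
  cut, which makes continuity immediate.\<close>

definition joukowsky_inv :: "complex \<Rightarrow> complex" where
  "joukowsky_inv z = ((csqrt (z + 2) - csqrt (z - 2)) / 2)\<^sup>2"

text \<open>For the roots \<open>a\<close> and \<open>c\<close> one has
  \<open>a\<^sup>2 - c\<^sup>2 = 4\<close>, so \<open>(a - c) / 2\<close> and
  \<open>(a + c) / 2\<close> are reciprocal, and their squares add up to \<open>z\<close>. Both
  roots lie in the open first quadrant, hence at an acute angle, which makes \<open>a - c\<close>
  shorter than \<open>a + c\<close>.\<close>

lemma joukowsky_inv:
  assumes z: "Im z > 0"
  shows "joukowsky_inv z \<noteq> 0" and "joukowsky_inv z + 1 / joukowsky_inv z = z"
    and "cmod (joukowsky_inv z) < 1"
proof -
  define a c where "a = csqrt (z + 2)" and "c = csqrt (z - 2)"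
  have sq: "a\<^sup>2 = z + 2" "c\<^sup>2 = z - 2" by (simp_all add: a_def c_def)
  have *: "(a - c) / 2 * ((a + c) / 2) = 1"
    using sq by (simp add: field_simps power2_eq_square)
  have J: "joukowsky_inv z = ((a - c) / 2)\<^sup>2" by (simp add: joukowsky_inv_def a_def c_def)
  from * have inv: "1 / joukowsky_inv z = ((a + c) / 2)\<^sup>2"
    unfolding J by (metis mult_eq_0_iff nonzero_eq_divide_eq one_power2 power_divide
        power_eq_0_iff power_mult_distrib mult.commute zero_neq_one)
  show "joukowsky_inv z \<noteq> 0" unfolding J using * by force
  show "joukowsky_inv z + 1 / joukowsky_inv z = z"
    unfolding inv unfolding J using sq by (simp add: power_divide power2_sum power2_diff field_simps)
  have "cmod x > \<bar>Re x\<bar>" if "Im x > 0" for x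
    using that
    by (metis abs_Re_le_cmod add_cancel_left_right cmod_power2 less_le power2_abs zero_eq_power2)
  then have pos: "Re (csqrt x) > 0" "Im (csqrt x) > 0" if "Im x > 0" for x
    using that by (fastforce simp: abs_less_iff)+
  have "0 < Re a * Re c + Im a * Im c"
    using pos[of "z + 2"] pos[of "z - 2"] z unfolding a_def c_def by (simp add: add_pos_pos del: csqrt.simps)
  then have "(cmod (a - c))\<^sup>2 < (cmod (a + c))\<^sup>2"
    unfolding cmod_power2 by (simp add: power2_eq_square algebra_simps)
  then have lt: "cmod (a - c) < cmod (a + c)" using power2_less_imp_less by force
  have "cmod (a - c) * cmod (a + c) = 4"
    using arg_cong[OF *, of cmod] by (simp add: norm_mult norm_divide)
  moreover have "cmod (a - c) * cmod (a - c) \<le> cmod (a - c) * cmod (a + c)"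
    using lt by (intro mult_left_mono) auto
  ultimately have "cmod (a - c) * cmod (a - c) < 4"
    using lt by (smt (verit) mult_cancel_left mult_eq_0_iff)
  then show "cmod (joukowsky_inv z) < 1"
    unfolding J by (simp add: norm_power norm_divide power2_eq_square norm_mult)
qed

lemma continuous_on_joukowsky_inv: "continuous_on {z. Im z > 0} joukowsky_inv"
proof -
  have "x \<notin> \<real>\<^sub>\<le>\<^sub>0" if "Im x > 0" for x
    using that by (auto simp: complex_nonpos_Reals_iff)
  then show ?thesis unfolding joukowsky_inv_def
    by (intro continuous_intros continuous_on_compose2[OF continuous_on_csqrt]) auto
qed

text \<open>Keeps the numerator and the denominator of \<open>(1 - k w) / (w - k)\<close> away from
  zero, since there \<open>k + 1 / k\<close> and \<open>w + 1 / w\<close> differ by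
  \<open>\<i> h\<close>.\<close>

lemma joukowsky_eq_iff:
  fixes w k :: complex
  assumes "w \<noteq> 0" "k \<noteq> 0"
  shows "w + 1 / w = k + 1 / k \<longleftrightarrow> w = k \<or> k * w = 1"
proof -
  have "(w - k) * (k * w - 1) = w * k * ((w + 1 / w) - (k + 1 / k))"
    using assms by (simp add: field_simps)
  then show ?thesis using assms by (metis eq_iff_diff_eq_0 mult_eq_0_iff)
qed

section \<open>Harmonic sums\<close>

text \<open>Each doubling from \<open>L\<close> to \<open>2 L\<close> adds \<open>L\<close> terms,
  none below \<open>1 / (2 L)\<close>, hence at least \<open>1 / 2\<close>.\<close>

lemma harmonic_block_sum:
  assumes "M \<ge> 1"
  shows "real q / 2 \<le> (\<Sum>j \<in> {M<..2 ^ q * M}. 1 / real j)"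
proof (induction q)
  case (Suc q)
  let ?L = "2 ^ q * M"
  have split: "{M<..2 ^ Suc q * M} = {M<..?L} \<union> {?L<..2 * ?L}"
  proof -
    have "M * 1 \<le> M * 2 ^ q" by (intro mult_le_mono2) simp
    then have "M \<le> ?L" by (simp add: mult.commute)
    then have "x \<in> {M<..2 * ?L} \<longleftrightarrow> x \<in> {M<..?L} \<union> {?L<..2 * ?L}" for x
      unfolding greaterThanAtMost_iff Un_iff by linarith
    then show ?thesis by (simp add: set_eq_iff mult.assoc)
  qed
  have "1 / 2 = (\<Sum>j \<in> {?L<..2 * ?L}. 1 / real (2 * ?L))"
    using assms by (simp add: field_simps)
  also have "\<dots> \<le> (\<Sum>j \<in> {?L<..2 * ?L}. 1 / real j)"
    using assms by (intro sum_mono divide_left_mono) (auto simp del: of_nat_mult)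
  finally show ?case unfolding split
    using Suc by (subst sum.union_disjoint) (auto simp: add_divide_distrib)
qed simp

section \<open>Eigenvalues of long wells by a fixed-point argument\<close>

lemma square_well_spectrum_approx:
  fixes h s :: real
  assumes h: "h > 0" and s: "s > 0"
  shows "\<exists>N0. \<forall>N\<ge>N0. \<exists>\<zeta>.
    inj_on \<zeta> {j. s \<le> 2 * pi * real j / real N \<and> 2 * pi * real j / real N \<le> 1} \<and>
    (\<forall>j. s \<le> 2 * pi * real j / real N \<and> 2 * pi * real j / real N \<le> 1 \<longrightarrow>
       \<zeta> j \<in> l2_spectrum (schrodinger (square_well (\<i> * of_real h) N)) \<and>
       cmod (\<zeta> j - (\<i> * of_real h + 2 * of_real (cos (2 * pi * real j / real N)))) \<le> h / 2)"
proof -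
  \<comment> \<open>A fixed box for the uniform continuity of the cosine, needed before the height
    of the smaller box \<open>S\<close> can be chosen.\<close>
  define K where "K = cbox (Complex 0 (- 1)) (Complex 2 1)"
  have "uniformly_continuous_on K (cos :: complex \<Rightarrow> complex)"
    unfolding K_def by (intro compact_uniformly_continuous continuous_intros compact_cbox)
  then obtain d where d: "d > 0"
    and cosd: "\<And>z z'. z \<in> K \<Longrightarrow> z' \<in> K \<Longrightarrow> cmod (z' - z) < d \<Longrightarrow> cmod (cos z' - cos z) < h / 4"
    using h unfolding uniformly_continuous_on_def dist_norm
    by (metis divide_pos_pos zero_less_numeral)
  \<comment> \<open>The bound by \<open>d\<close> controls the cosine, the bound by 1 keeps
    \<open>S\<close> inside \<open>K\<close> and \<open>\<theta> + \<delta>\<close> at most 2, and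
    the bound by \<open>s\<close> keeps the balls around \<open>\<theta> \<ge> s\<close> in the
    right half-plane.\<close>
  define \<delta> where "\<delta> = min (d / 2) (min 1 (s / 2))"
  have \<delta>: "\<delta> > 0" "\<delta> < d" "\<delta> \<le> 1" "\<delta> < s" using d s by (auto simp: \<delta>_def)
  define S where "S = cbox (Complex 0 (- \<delta>)) (Complex 2 \<delta>)"
  have S_iff: "z \<in> S \<longleftrightarrow> 0 \<le> Re z \<and> Re z \<le> 2 \<and> \<bar>Im z\<bar> \<le> \<delta>" for z
    by (auto simp: S_def in_cbox_complex_iff)
  have K_iff: "z \<in> K \<longleftrightarrow> 0 \<le> Re z \<and> Re z \<le> 2 \<and> \<bar>Im z\<bar> \<le> 1" for z
    by (auto simp: K_def in_cbox_complex_iff)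
  define \<Lambda> where "\<Lambda> z = \<i> * of_real h + 2 * cos z" for z :: complex
  define w where "w z = exp (\<i> * z)" for z :: complex
  define k where "k z = joukowsky_inv (\<Lambda> z)" for z
  define G where "G z = (1 - k z * w z) / (w z - k z)" for z
  have w0: "w z \<noteq> 0" for z by (simp add: w_def)
  have \<Lambda>w: "\<Lambda> z = w z + 1 / w z + \<i> * of_real h" for z
    by (simp add: \<Lambda>_def w_def cos_exp_eq exp_minus inverse_eq_divide)
  have Im_\<Lambda>: "Im (\<Lambda> z) > 0" if z: "z \<in> S" for z
  proof -
    have "z - of_real (Re z) = \<i> * of_real (Im z)" by (simp add: complex_eq_iff)
    then have "cmod (z - of_real (Re z)) = \<bar>Im z\<bar>" by (simp add: norm_mult)
    then have "cmod (cos z - cos (of_real (Re z))) < h / 4"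
      \<comment> \<open>On the real axis \<open>Im \<Lambda>\<close> equals \<open>h\<close>; a
        vertical move by at most \<open>\<delta>\<close> changes \<open>2 cos\<close> by less than
        \<open>h / 2\<close>.\<close>
      using z \<delta> by (intro cosd) (auto simp: S_iff K_iff)
    then have "\<bar>Im (cos z - cos (of_real (Re z)))\<bar> < h / 4"
      using abs_Im_le_cmod order_le_less_trans by blast
    then show ?thesis using h by (simp add: \<Lambda>_def cos_of_real)
  qed
  have k0: "k z \<noteq> 0" and k1: "k z + 1 / k z = \<Lambda> z" and k2: "cmod (k z) < 1" if "z \<in> S" for z
    using joukowsky_inv[OF Im_\<Lambda>[OF that]] by (simp_all add: k_def)
  have wk: "w z - k z \<noteq> 0 \<and> 1 - k z * w z \<noteq> 0" if z: "z \<in> S" for z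
  proof -
    have "w z + 1 / w z \<noteq> k z + 1 / k z" using k1[OF z] \<Lambda>w[of z] h by simp
    then show ?thesis using joukowsky_eq_iff[OF w0 k0[OF z]] by auto
  qed
  have "continuous_on S k"
    unfolding k_def
    by (rule continuous_on_compose2[OF continuous_on_joukowsky_inv])
       (auto simp: \<Lambda>_def intro!: continuous_intros Im_\<Lambda>[unfolded \<Lambda>_def])
  then have "continuous_on S G"
    unfolding G_def w_def using wk by (intro continuous_intros) (auto simp: w_def)
  moreover have "contractible S" unfolding S_def by (intro convex_imp_contractible convex_box)
  moreover have "G z \<noteq> 0" if "z \<in> S" for z using wk[OF that] by (simp add: G_def)
  ultimately obtain \<phi> where \<phi>: "continuous_on S \<phi>" "\<And>z. z \<in> S \<Longrightarrow> G z = exp (\<phi> z)"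
    using continuous_logarithm_on_contractible by metis
  have "bounded (\<phi> ` S)"
    using \<phi>(1) by (intro compact_imp_bounded compact_continuous_image) (simp_all add: S_def)
  then obtain C where C: "C > 0" "\<And>z. z \<in> S \<Longrightarrow> cmod (\<phi> z) \<le> C"
    unfolding bounded_pos by auto
  \<comment> \<open>From here on \<open>C / N \<le> \<delta>\<close>, so the fixed-point map sends
    every ball of radius \<open>\<delta>\<close> around an admissible \<open>\<theta> j\<close> to
    itself.\<close>
  define N0 where "N0 = nat \<lceil>C / \<delta>\<rceil> + 1"
  show ?thesis
  proof (intro exI[of _ N0] allI impI)
    fix N assume N: "N \<ge> N0"
    define \<theta> where "\<theta> j = 2 * pi * real j / real N" for j
    define J where "J = {j. s \<le> \<theta> j \<and> \<theta> j \<le> 1}"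
    have N1: "N \<ge> 1" using N by (simp add: N0_def)
    have "C / \<delta> \<le> real N" using N unfolding N0_def by linarith
    then have CN: "C / real N \<le> \<delta>" using \<delta>(1) N1 by (simp add: field_simps)
    have sub: "cball (of_real (\<theta> j)) \<delta> \<subseteq> S \<inter> {z. Re z > 0}" if "j \<in> J" for j
    proof
      fix z assume "z \<in> cball (of_real (\<theta> j) :: complex) \<delta>"
      then have "cmod (z - of_real (\<theta> j)) \<le> \<delta>" by (simp add: dist_norm norm_minus_commute)
      then have "\<bar>Re z - \<theta> j\<bar> \<le> \<delta>" "\<bar>Im z\<bar> \<le> \<delta>"
        using abs_Re_le_cmod[of "z - of_real (\<theta> j)"] abs_Im_le_cmod[of "z - of_real (\<theta> j)"] by simp_all
      then show "z \<in> S \<inter> {z. Re z > 0}" using that \<delta> by (auto simp: S_iff J_def)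
    qed
    have "\<exists>z \<in> cball (of_real (\<theta> j)) \<delta>.
        of_real (\<theta> j) - \<i> * \<phi> z / of_nat N = z" if j: "j \<in> J" for j
    proof -
      let ?F = "\<lambda>z. of_real (\<theta> j) - \<i> * \<phi> z / of_nat N"
      have "continuous_on (cball (of_real (\<theta> j)) \<delta>) ?F"
        using \<phi>(1) sub[OF j] N1 by (intro continuous_intros) (auto elim: continuous_on_subset)
      moreover have "?F \<in> cball (of_real (\<theta> j)) \<delta> \<rightarrow> cball (of_real (\<theta> j)) \<delta>"
      proof
        fix z assume "z \<in> cball (of_real (\<theta> j) :: complex) \<delta>"
        then have "cmod (\<phi> z) \<le> C" using sub[OF j] C(2) by auto
        then have "cmod (\<phi> z) / real N \<le> C / real N" by (simp add: divide_right_mono)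
        then show "?F z \<in> cball (of_real (\<theta> j)) \<delta>"
          using CN by (simp add: dist_norm norm_mult norm_divide)
      qed
      ultimately obtain z where "z \<in> cball (of_real (\<theta> j)) \<delta>" "?F z = z"
        by (rule brouwer_ball[OF \<delta>(1)])
      then show ?thesis by blast
    qed
    then have "\<forall>j\<in>J. \<exists>z. z \<in> cball (of_real (\<theta> j)) \<delta> \<and>
        of_real (\<theta> j) - \<i> * \<phi> z / of_nat N = z"
      by blast
    from bchoice[OF this] obtain \<xi> where \<xi>: "\<And>j. j \<in> J \<Longrightarrow> \<xi> j \<in> cball (of_real (\<theta> j)) \<delta>"
      and fix_\<xi>: "\<And>j. j \<in> J \<Longrightarrow> of_real (\<theta> j) - \<i> * \<phi> (\<xi> j) / of_nat N = \<xi> j"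
      by blast
    have \<xi>S: "\<xi> j \<in> S" and \<xi>pos: "Re (\<xi> j) > 0" if "j \<in> J" for j
      using \<xi>[OF that] sub[OF that] by auto
    have \<xi>2: "Re (\<xi> j) \<le> 2" if "j \<in> J" for j using \<xi>S[OF that] by (simp add: S_iff)
    have inj: "inj_on (\<lambda>j. \<Lambda> (\<xi> j)) J"
    proof (rule inj_onI)
      fix i j assume ij: "i \<in> J" "j \<in> J" and eq: "\<Lambda> (\<xi> i) = \<Lambda> (\<xi> j)"
      then have "cos (\<xi> i) = cos (\<xi> j)" by (simp add: \<Lambda>_def)
      then obtain m :: real where "m \<in> \<int>"
        and m: "\<xi> i = \<xi> j + of_real (2 * m * pi) \<or> \<xi> i = - \<xi> j + of_real (2 * m * pi)"
        unfolding complex_cos_eq by blast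
      from this(1) obtain n where "m = of_int n" by (rule Ints_cases)
      note n = m[unfolded this]
      \<comment> \<open>Since both real parts lie in \<open>(0, 2]\<close>, the only possible
        translation in the first case is 0, and the reflected case is impossible.\<close>
      have b: "\<bar>Re (\<xi> i) - Re (\<xi> j)\<bar> < 2 * pi"
        "0 < Re (\<xi> i) + Re (\<xi> j)" "Re (\<xi> i) + Re (\<xi> j) < 2 * pi"
        using \<xi>pos[OF ij(1)] \<xi>pos[OF ij(2)] \<xi>2[OF ij(1)] \<xi>2[OF ij(2)] pi_gt3 by linarith+
      have nz: "\<not> (0 < 2 * of_int n * pi \<and> 2 * of_int n * pi < 2 * pi)"
        by (simp add: zero_less_mult_iff)
      have n0: "n = 0" if "\<bar>2 * of_int n * pi\<bar> < 2 * pi" using that by (simp add: abs_mult)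
      have "\<xi> i = \<xi> j"
        using n
      proof
        assume e: "\<xi> i = \<xi> j + of_real (2 * of_int n * pi)"
        then have "Re (\<xi> i) - Re (\<xi> j) = 2 * of_int n * pi" by simp
        with b(1) n0 e show ?thesis by simp
      next
        assume e: "\<xi> i = - \<xi> j + of_real (2 * of_int n * pi)"
        then have "Re (\<xi> i) + Re (\<xi> j) = 2 * of_int n * pi" by simp
        with b nz show ?thesis by metis
      qed
      \<comment> \<open>The fixed-point equation expresses \<open>\<theta>\<close> through the fixed
        point.\<close>
      then have "of_real (\<theta> i) = (of_real (\<theta> j) :: complex)"
        using fix_\<xi>[OF ij(1)] fix_\<xi>[OF ij(2)] by (metis diff_add_cancel)
      then show "i = j" using N1 by (simp add: \<theta>_def)
    qed
    have spec: "\<Lambda> (\<xi> j) \<in> l2_spectrum (schrodinger (square_well (\<i> * of_real h) N))"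
      if j: "j \<in> J" for j
    proof -
      let ?z = "\<xi> j"
      note z = \<xi>S[OF j]
      \<comment> \<open>Multiplying the fixed-point equation by \<open>\<i> N\<close> and
        exponentiating removes the multiple of \<open>2 \<pi> \<i>\<close> and leaves
        \<open>w\<^sup>N = G\<close>.\<close>
      have "?z * of_nat N = of_real (\<theta> j) * of_nat N - \<i> * \<phi> ?z"
        using arg_cong[OF fix_\<xi>[OF j], of "\<lambda>x. x * of_nat N"] N1
        by (simp add: left_diff_distrib)
      then have "\<i> * (?z * of_nat N) = \<i> * (of_real (\<theta> j) * of_nat N) + \<phi> ?z"
        by (simp only: right_diff_distrib) simp
      also have "of_real (\<theta> j) * of_nat N = (2 * pi * of_nat j :: complex)"
        using N1 by (simp add: \<theta>_def)
      finally have "w ?z ^ N = exp (\<i> * (2 * pi * of_nat j) + \<phi> ?z)"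
        by (simp add: w_def mult_ac flip: exp_of_nat_mult)
      also have "\<dots> = G ?z"
        using exp_integer_2pi[of "of_nat j"] \<phi>(2)[OF z] by (simp add: exp_add mult_ac)
      finally have q: "w ?z ^ N * (w ?z - k ?z) = 1 - k ?z * w ?z"
        using wk[OF z] by (simp add: G_def)
      \<comment> \<open>Otherwise \<open>Re ?z\<close> would be a positive multiple of
        \<open>\<pi>\<close>, but it is at most 2.\<close>
      have w2: "(w ?z)\<^sup>2 \<noteq> 1"
      proof
        assume "(w ?z)\<^sup>2 = 1"
        then have "exp (2 * \<i> * ?z) = 1" by (simp add: w_def mult_ac flip: exp_double)
        then obtain n :: int where "Re ?z = of_int n * pi" by (auto simp: exp_eq_1)
        moreover from this have "1 \<le> n" using \<xi>pos[OF j] by (simp add: zero_less_mult_iff)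
        then have "1 * pi \<le> of_int n * pi" by (intro mult_right_mono) auto
        ultimately show False using \<xi>2[OF j] pi_gt3 by simp
      qed
      show ?thesis
        using square_well_eigenvalue[OF k0[OF z] k2[OF z] w0 w2 N1 _ q] k1[OF z] \<Lambda>w[of ?z] by simp
    qed
    have close: "cmod (\<Lambda> (\<xi> j) - (\<i> * of_real h + 2 * of_real (cos (\<theta> j)))) \<le> h / 2"
      if j: "j \<in> J" for j
    proof -
      have "cmod (\<xi> j - of_real (\<theta> j)) < d"
        using \<xi>[OF j] \<delta> by (simp add: dist_norm norm_minus_commute)
      moreover have "\<xi> j \<in> K" "of_real (\<theta> j) \<in> K"
        using \<xi>S[OF j] j \<delta> s by (auto simp: S_iff K_iff J_def)
      ultimately have "cmod (cos (\<xi> j) - cos (of_real (\<theta> j))) < h / 4" by (intro cosd)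
      moreover have "\<Lambda> (\<xi> j) - (\<i> * of_real h + 2 * of_real (cos (\<theta> j)))
          = 2 * (cos (\<xi> j) - cos (of_real (\<theta> j)))"
        by (simp add: \<Lambda>_def cos_of_real algebra_simps)
      ultimately show ?thesis by (simp only: norm_mult) simp
    qed
    show "\<exists>\<zeta>. inj_on \<zeta> {j. s \<le> 2 * pi * real j / real N \<and> 2 * pi * real j / real N \<le> 1} \<and>
      (\<forall>j. s \<le> 2 * pi * real j / real N \<and> 2 * pi * real j / real N \<le> 1 \<longrightarrow>
       \<zeta> j \<in> l2_spectrum (schrodinger (square_well (\<i> * of_real h) N)) \<and>
       cmod (\<zeta> j - (\<i> * of_real h + 2 * of_real (cos (2 * pi * real j / real N)))) \<le> h / 2)"
      using inj spec close unfolding J_def \<theta>_def by blast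
  qed
qed

section \<open>Lower bounds for the eigenvalue sum\<close>

lemma eigenvalue_term_lower_bound:
  fixes p \<sigma> h \<theta> :: real
  assumes p: "p \<ge> 1" and \<sigma>: "\<sigma> \<ge> 1 / 2" and h: "0 < h" "h \<le> \<theta>\<^sup>2" and \<theta>: "0 < \<theta>" "\<theta> \<le> 1"
    and z: "cmod (z - (\<i> * of_real h + 2 * of_real (cos \<theta>))) \<le> h / 2"
  shows "z \<notin> essential_interval"
    and "(h / 2) powr p / 17 powr \<sigma> / \<theta>
      \<le> infdist z essential_interval powr p / cmod (z\<^sup>2 - 4) powr \<sigma>"
proof -
  let ?e = "z - (\<i> * of_real h + 2 * of_real (cos \<theta>))"
  have "\<bar>Im ?e\<bar> \<le> h / 2" using z abs_Im_le_cmod[of ?e] by linarith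
  then have im: "Im z \<ge> h / 2" unfolding abs_le_iff by simp
  then show "z \<notin> essential_interval" using h by (auto simp: essential_interval_def)
  have ne: "essential_interval \<noteq> {}" by (auto simp: essential_interval_def)
  have "h / 2 \<le> infdist z essential_interval"
    unfolding infdist_notempty[OF ne]
  proof (rule cINF_greatest[OF ne])
    fix x assume "x \<in> essential_interval"
    then have "Im x = 0" by (auto simp: essential_interval_def)
    then show "h / 2 \<le> dist z x" using im abs_Im_le_cmod[of "z - x"] by (simp add: dist_norm)
  qed
  then have num: "(h / 2) powr p \<le> infdist z essential_interval powr p"
    using h p by (intro powr_mono2) auto
  have \<theta>1: "\<theta>\<^sup>2 \<le> 1" using \<theta> by (simp add: power_le_one)
  have "1 - \<theta>\<^sup>2 / 2 \<le> cos \<theta>"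
    using cos_double_sin[of "\<theta> / 2"] abs_sin_x_le_abs_x[of "\<theta> / 2"] \<theta>
      power_mono[of "\<bar>sin (\<theta> / 2)\<bar>" "\<theta> / 2" 2]
    by (simp add: power_divide)
  then have c: "cmod (2 * of_real (cos \<theta>) - 2) \<le> \<theta>\<^sup>2"
    using norm_of_real[of "2 * cos \<theta> - 2", where ?'a = complex] by simp
  have "z - 2 = ?e + (2 * of_real (cos \<theta>) - 2) + \<i> * of_real h" by simp
  then have "cmod (z - 2)
      \<le> cmod ?e + cmod (2 * of_real (cos \<theta>) - 2 :: complex) + cmod (\<i> * of_real h)"
    by (metis norm_triangle_ineq add_mono_thms_linordered_semiring(3) order_trans)
  \<comment> \<open>The three parts are at most \<open>h / 2\<close>,
    \<open>\<theta>\<^sup>2\<close> and \<open>h\<close>, with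
    \<open>h \<le> \<theta>\<^sup>2\<close>. The constant 17 below rounds up
    \<open>5 / 2 * 13 / 2\<close>.\<close>
  then have z2: "cmod (z - 2) \<le> 5 / 2 * \<theta>\<^sup>2" using z c h by (simp add: norm_mult)
  have "cmod (z + 2) \<le> cmod (z - 2) + cmod 4"
    using norm_triangle_ineq[of "z - 2" 4] by (simp add: add.commute)
  then have z3: "cmod (z + 2) \<le> 13 / 2" using z2 \<theta>1 by simp
  have "z\<^sup>2 - 4 = (z - 2) * (z + 2)" by (simp add: power2_eq_square algebra_simps)
  then have "cmod (z\<^sup>2 - 4) = cmod (z - 2) * cmod (z + 2)" by (simp add: norm_mult)
  also have "\<dots> \<le> (5 / 2 * \<theta>\<^sup>2) * (13 / 2)" using z2 z3 by (intro mult_mono) auto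
  also have "\<dots> \<le> 17 * \<theta>\<^sup>2" by simp
  finally have "cmod (z\<^sup>2 - 4) powr \<sigma> \<le> (17 * \<theta>\<^sup>2) powr \<sigma>"
    using \<sigma> by (intro powr_mono2) auto
  also have "\<dots> = 17 powr \<sigma> * \<theta> powr (2 * \<sigma>)"
    using \<theta> by (simp add: powr_mult powr_powr flip: powr_numeral)
  \<comment> \<open>The assumption \<open>\<sigma> \<ge> 1 / 2\<close> enters here:
    \<open>\<theta> \<le> 1\<close> and the exponent \<open>2 \<sigma>\<close> is at least
    1.\<close>
  also have "\<dots> \<le> 17 powr \<sigma> * \<theta>"
    using \<theta> \<sigma> powr_mono'[of 1 "2 * \<sigma>" \<theta>] by (intro mult_left_mono) auto
  finally have den: "cmod (z\<^sup>2 - 4) powr \<sigma> \<le> 17 powr \<sigma> * \<theta>" .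
  \<comment> \<open>With a zero denominator the quotient would take the default value 0 and the
    lower bound would fail.\<close>
  have "z\<^sup>2 \<noteq> 4"
  proof
    assume "z\<^sup>2 = 4"
    then have "z\<^sup>2 = 2\<^sup>2" by simp
    then have "z = 2 \<or> z = - 2" by (simp only: power2_eq_iff)
    then show False using im h by auto
  qed
  then have "cmod (z\<^sup>2 - 4) powr \<sigma> > 0" by simp
  then have "(h / 2) powr p / (17 powr \<sigma> * \<theta>)
      \<le> infdist z essential_interval powr p / cmod (z\<^sup>2 - 4) powr \<sigma>"
    using num den by (intro frac_le) auto
  then show "(h / 2) powr p / 17 powr \<sigma> / \<theta>
      \<le> infdist z essential_interval powr p / cmod (z\<^sup>2 - 4) powr \<sigma>" by simp
qed

text \<open>The spectrum is summed as a set, so only an injective labelling of eigenvalues lets a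
  sum over indices bound it from below.\<close>

lemma sum_le_infsum_ennreal:
  fixes f :: "'a \<Rightarrow> real" and g :: "'b \<Rightarrow> real"
  assumes "finite J" "inj_on \<zeta> J" "\<zeta> ` J \<subseteq> D" "\<And>j. j \<in> J \<Longrightarrow> 0 \<le> g j"
    and "\<And>j. j \<in> J \<Longrightarrow> g j \<le> f (\<zeta> j)"
  shows "ennreal (\<Sum>j\<in>J. g j) \<le> (\<Sum>\<^sub>\<infinity>z\<in>D. ennreal (f z))"
proof -
  have "ennreal (\<Sum>j\<in>J. g j) = (\<Sum>j\<in>J. ennreal (g j))"
    using assms(4) by simp
  also have "\<dots> \<le> (\<Sum>j\<in>J. ennreal (f (\<zeta> j)))"
    using assms(5) by (intro sum_mono ennreal_leI)
  also have "\<dots> = (\<Sum>z\<in>\<zeta> ` J. ennreal (f z))"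
    using assms(2) by (simp add: sum.reindex)
  also have "\<dots> \<le> (\<Sum>\<^sub>\<infinity>z\<in>D. ennreal (f z))"
    using assms(1,3) by (subst nonneg_infsum_complete) (auto intro!: SUP_upper)
  finally show ?thesis .
qed

lemma ennreal_unbounded_eq_top:
  fixes x :: ennreal
  assumes "\<And>n. of_nat n \<le> x"
  shows "x = \<infinity>"
proof (rule ccontr)
  assume "x \<noteq> \<infinity>"
  then have "x < top" by (simp add: less_top)
  then obtain n where "x < of_nat n" using ennreal_Ex_less_of_nat by blast
  with assms[of n] show False by (simp add: leD)
qed

lemma square_well_lp:
  assumes "p \<ge> 1"
  shows "square_well c N \<in> lp p"
    and "lp_norm p (square_well c N) powr p = real N * cmod c powr p"
proof -
  let ?f = "\<lambda>n. cmod (square_well c N n) powr p"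
  have supp: "?f n = (if n \<in> {1..int N} then cmod c powr p else 0)" for n
    by (auto simp: square_well_def)
  have "(?f has_sum (\<Sum>n\<in>{1..int N}. cmod c powr p)) UNIV"
    by (rule has_sum_cong_neutral[THEN iffD1, OF _ _ _ has_sum_finite[of "{1..int N}"]])
       (auto simp: supp)
  then have *: "(?f has_sum (real N * cmod c powr p)) UNIV" by simp
  then show "square_well c N \<in> lp p" unfolding lp_def using has_sum_imp_summable by blast
  show "lp_norm p (square_well c N) powr p = real N * cmod c powr p"
    unfolding lp_norm_def infsumI[OF *] using assms by (simp add: powr_powr)
qed

section \<open>Choice of wells with unbounded quotients\<close>

theorem theorem3:
  fixes p \<sigma> :: real
  assumes "p \<ge> 1" and "\<sigma> \<ge> 1 / 2"
  shows "(SUP b \<in> {b \<in> lp p. b \<noteq> (\<lambda>n. 0)}.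
            ennreal (1 / lp_norm p b powr p) *
            (\<Sum>\<^sub>\<infinity>z \<in> discrete_spectrum b.
               ennreal (infdist z essential_interval powr p / cmod (z\<^sup>2 - 4) powr \<sigma>)))
         = \<infinity>"
    (is "(SUP b \<in> ?B. ?R b) = \<infinity>")
proof -
  \<comment> \<open>Chosen so that the normalised lower bound for the \<open>j\<close>-th term is
    \<open>2 c / j\<close>; the factor 2 absorbs the \<open>1 / 2\<close> gained per dyadic
    block.\<close>
  define c where "c = 1 / (2 powr p * 17 powr \<sigma> * (4 * pi))"
  have c: "c > 0" by (simp add: c_def)
  have key: "\<exists>b \<in> ?B. ennreal (c * real q) \<le> ?R b" for q :: nat
  proof -
    \<comment> \<open>The least angle used; \<open>h = s\<^sup>2\<close> then guarantees
      \<open>h \<le> \<theta>\<^sup>2\<close> for every angle from \<open>s\<close> on.\<close>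
    define s :: real where "s = 1 / 2 ^ (q + 3)"
    define h where "h = s\<^sup>2"
    have s: "s > 0" and h: "h > 0" by (simp_all add: s_def h_def)
    obtain N0 where N0: "\<And>N. N \<ge> N0 \<Longrightarrow> \<exists>\<zeta>.
        inj_on \<zeta> {j. s \<le> 2 * pi * real j / real N \<and> 2 * pi * real j / real N \<le> 1} \<and>
        (\<forall>j. s \<le> 2 * pi * real j / real N \<and> 2 * pi * real j / real N \<le> 1 \<longrightarrow>
           \<zeta> j \<in> l2_spectrum (schrodinger (square_well (\<i> * of_real h) N)) \<and>
           cmod (\<zeta> j - (\<i> * of_real h + 2 * of_real (cos (2 * pi * real j / real N)))) \<le> h / 2)"
      using square_well_spectrum_approx[OF h s] by blast
    define M where "M = max N0 1"
    \<comment> \<open>For \<open>M < j \<le> 2 ^ q * M\<close> the angle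
      \<open>2 \<pi> j / N\<close> lies between \<open>s\<close> and 1; the 3 in the exponent comes
      from \<open>2 \<pi> \<le> 8\<close>.\<close>
    define N where "N = 2 ^ (q + 3) * M"
    define b where "b = square_well (\<i> * of_real h) N"
    define \<theta> where "\<theta> j = 2 * pi * real j / real N" for j
    define J where "J = {M<..2 ^ q * M}"
    have M: "M \<ge> 1" by (simp add: M_def)
    have "1 * M \<le> N" unfolding N_def by (intro mult_le_mono1) simp
    then have N: "N \<ge> N0" "N \<ge> 1" by (simp_all add: M_def)
    obtain \<zeta> where inj: "inj_on \<zeta> {j. s \<le> \<theta> j \<and> \<theta> j \<le> 1}"
      and \<zeta>: "\<And>j. s \<le> \<theta> j \<Longrightarrow> \<theta> j \<le> 1 \<Longrightarrow> \<zeta> j \<in> l2_spectrum (schrodinger b)"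
        "\<And>j. s \<le> \<theta> j \<Longrightarrow> \<theta> j \<le> 1 \<Longrightarrow>
          cmod (\<zeta> j - (\<i> * of_real h + 2 * of_real (cos (\<theta> j)))) \<le> h / 2"
      using N0[OF N(1)] unfolding \<theta>_def b_def by blast
    have J: "s \<le> \<theta> j" "\<theta> j \<le> 1" if j: "j \<in> J" for j
    proof -
      have "real M \<le> real j" using j by (simp add: J_def)
      also have "\<dots> \<le> 2 * pi * real j" using pi_gt3 mult_right_mono[of 1 "2 * pi" "real j"] by simp
      finally show "s \<le> \<theta> j" using M by (simp add: s_def \<theta>_def N_def field_simps)
      have "real j \<le> real (2 ^ q * M)" using j unfolding J_def by (intro of_nat_mono) simp
      then have "2 * pi * real j \<le> 8 * real (2 ^ q * M)"
        using pi_less_4 by (intro mult_mono) auto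
      then show "\<theta> j \<le> 1" using N(2) by (simp add: \<theta>_def N_def power_add)
    qed
    have bound: "\<zeta> j \<in> discrete_spectrum b"
      "(h / 2) powr p / 17 powr \<sigma> / \<theta> j
        \<le> infdist (\<zeta> j) essential_interval powr p / cmod ((\<zeta> j)\<^sup>2 - 4) powr \<sigma>" if "j \<in> J" for j
    proof -
      have "h \<le> (\<theta> j)\<^sup>2" "0 < \<theta> j" using J(1)[OF that] s by (auto simp: h_def power_mono)
      note eigenvalue_term_lower_bound[OF assms h this J(2)[OF that] \<zeta>(2)[OF J[OF that]]]
      then show "\<zeta> j \<in> discrete_spectrum b"
        "(h / 2) powr p / 17 powr \<sigma> / \<theta> j
          \<le> infdist (\<zeta> j) essential_interval powr p / cmod ((\<zeta> j)\<^sup>2 - 4) powr \<sigma>"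
        using \<zeta>(1)[OF J[OF that]] by (simp_all add: discrete_spectrum_def)
    qed
    have nrm: "lp_norm p b powr p = real N * h powr p"
      using square_well_lp(2)[OF assms(1)] h by (simp add: b_def norm_mult)
    have "c * real q \<le> 2 * c * (\<Sum>j\<in>J. 1 / real j)"
      using harmonic_block_sum[OF M, of q] c by (simp add: J_def field_simps)
    \<comment> \<open>The factor \<open>N\<close> cancels against
      \<open>\<theta> j = 2 \<pi> j / N\<close>, and \<open>h powr p\<close> against the numerator,
      so the bound depends on neither.\<close>
    also have "\<dots> = (\<Sum>j\<in>J. 1 / (real N * h powr p) * ((h / 2) powr p / 17 powr \<sigma> / \<theta> j))"
      unfolding sum_distrib_left
      using h N(2) by (intro sum.cong) (auto simp: c_def \<theta>_def powr_divide)
    also have "\<dots> = 1 / lp_norm p b powr p * (\<Sum>j\<in>J. (h / 2) powr p / 17 powr \<sigma> / \<theta> j)"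
      by (simp add: sum_distrib_left nrm)
    finally have "ennreal (c * real q)
        \<le> ennreal (1 / lp_norm p b powr p) *
          ennreal (\<Sum>j\<in>J. (h / 2) powr p / 17 powr \<sigma> / \<theta> j)"
      by (subst ennreal_mult[symmetric]) (auto simp: \<theta>_def intro!: sum_nonneg ennreal_leI)
    also have "\<dots> \<le> ?R b"
    proof (intro mult_left_mono sum_le_infsum_ennreal[where \<zeta> = \<zeta>])
      show "inj_on \<zeta> J" using inj J by (auto intro: inj_on_subset)
      show "\<zeta> ` J \<subseteq> discrete_spectrum b" using bound(1) by blast
    qed (use bound(2) in \<open>auto simp: J_def \<theta>_def\<close>)
    finally have "ennreal (c * real q) \<le> ?R b" .
    moreover have "b 1 \<noteq> 0" using h N(2) by (simp add: b_def square_well_def)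
    then have "b \<in> ?B" using square_well_lp(1)[OF assms(1)] by (auto simp: b_def)
    ultimately show ?thesis by blast
  qed
  have "of_nat n \<le> (SUP b \<in> ?B. ?R b)" for n
  proof -
    obtain q where "real n / c \<le> real q" using real_arch_simple by blast
    then have "real n \<le> c * real q" using c by (simp add: field_simps)
    then have "of_nat n \<le> ennreal (c * real q)" by (simp add: ennreal_of_nat_eq_real_of_nat)
    also obtain b where b: "b \<in> ?B" "ennreal (c * real q) \<le> ?R b" using key by blast
    have "ennreal (c * real q) \<le> (SUP b \<in> ?B. ?R b)"
      using b(2) SUP_upper[OF b(1), of ?R] by (rule order_trans)
    finally show ?thesis .
  qed
  then show ?thesis by (rule ennreal_unbounded_eq_top)
qed

end
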